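(* Let $W=\{n \in \mathbb{N}: \text{for every prime } p,\ p\mid n \Rightarrow p^2\mid n\}$ be the set of powerful numbers. There is $N_0$ such that for every $N\ge N_0$: if $a_0$ is a non-negative integer and $A=\{a_1, \ldots, a_d\}$ is a set of positive integers with $H(a_0; a_1, \ldots, a_d) \subset W \cap [1,N]$, then \[ d \leq 5(\log N)^2. \]
   Context: For integers $a_0\neq 0, a_1,\dots,a_d$, the Hilbert cube is $H(a_0;a_1,\dots,a_d)=\{a_0+\sum_{i=1}^d \varepsilon_i a_i : \varepsilon_i\in\{0,1\}\}$; for $a_0=0$ the empty sum is excluded: $H(0;a_1,\dots,a_d)=\{\sum_{i=1}^d \varepsilon_i a_i : \varepsilon_i\in\{0,1\},\ \sum_i \varepsilon_i>0\}$. $\log$ is the natural logarithm. *)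

theory Defs
  imports Complex_Main "HOL-Computational_Algebra.Primes"
begin

definition powerful_numbers :: "nat set" where
  "powerful_numbers = {n. n > 0 \<and> (\<forall>p. prime p \<longrightarrow> p dvd n \<longrightarrow> p\<^sup>2 dvd n)}"

(* Only the values a 1, ..., a d of the generator function matter. For a0 = 0 the
   choice of all epsilons equal to 0 (the empty sum) is excluded. *)
definition hilbert_cube :: "int \<Rightarrow> nat \<Rightarrow> (nat \<Rightarrow> int) \<Rightarrow> int set" where
  "hilbert_cube a0 d a =
    (if a0 \<noteq> 0
     then {a0 + (\<Sum>i=1..d. \<epsilon> i * a i) |\<epsilon>. \<forall>i\<in>{1..d}. \<epsilon> i \<in> {0, 1}}
     else {(\<Sum>i=1..d. \<epsilon> i * a i) |\<epsilon>.
             (\<forall>i\<in>{1..d}. \<epsilon> i \<in> {0, 1}) \<and> (\<Sum>i=1..d. \<epsilon> i) > 0})"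

end

theory Submission
  imports Defs "HOL-Number_Theory.Prime_Powers" "HOL-Number_Theory.Cong" "HOL-Real_Asymp.Real_Asymp"
begin

text \<open>For each prime \<open>p\<close>, fewer than \<open>p\<^sup>2\<close> of the \<open>a\<^sub>i\<close> are prime to \<open>p\<close>, since otherwise some
  element of the cube would be divisible by \<open>p\<close> exactly once. As the distinct primes dividing
  \<open>a\<^sub>i \<le> N\<close> have a product of at most \<open>N\<close>, counting pairs \<open>p dvd a\<^sub>i\<close> with weight \<open>ln p\<close> gives
  \<open>(\<Sum>p\<le>n. (d - p\<^sup>2) * ln p) \<le> d * ln N\<close>. If \<open>d > 5 * (ln N)\<^sup>2\<close>, one may take \<open>n\<close> close to
  \<open>sqrt 5 * ln N\<close>; then \<open>n\<^sup>2 \<le> d\<close> and Chebyshev's lower bound \<open>\<theta>(x) \<ge> c * x - C\<close> makes the left side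
  at least \<open>(2 / 3) * c * n * d\<close> up to lower order terms. This is a contradiction as soon as
  \<open>c > 3 / (2 * sqrt 5) = 0.6708\<dots>\<close>, which any \<open>c\<close> close enough to \<open>ln 2\<close> satisfies.\<close>

section \<open>Chebyshev's lower bound for the function theta\<close>

definition prime_theta :: "nat \<Rightarrow> real" where
  "prime_theta n = (\<Sum>p | prime p \<and> p \<le> n. ln (real p))"

lemma finite_primes_le: "finite {p::nat. prime p \<and> p \<le> n}"
  by (rule finite_subset[of _ "{..n}"]) auto

lemma prime_theta_nonneg: "prime_theta n \<ge> 0"
  unfolding prime_theta_def
  by (intro sum_nonneg ln_ge_zero) (auto dest: prime_ge_1_nat)

lemma prime_theta_mono:
  assumes "m \<le> n"
  shows "prime_theta m \<le> prime_theta n"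
  unfolding prime_theta_def
proof (rule sum_mono2[OF finite_primes_le])
  show "{p. prime p \<and> p \<le> m} \<subseteq> {p. prime p \<and> p \<le> n}"
    using assms by auto
qed (auto intro!: ln_ge_zero dest: prime_ge_1_nat)

text \<open>Legendre's formula: passing from \<open>n\<close> to \<open>n + 1\<close> adds
  \<open>ln (n + 1)\<close>, which is the sum of \<open>mangoldt d\<close> over the divisors of
  \<open>n + 1\<close>, and these are exactly the \<open>d\<close> for which \<open>n div d\<close>
  grows by one. Terms with \<open>d > n\<close> vanish; the free upper limit \<open>N\<close> lets
  \<open>ln (fact n)\<close> and \<open>ln (fact (2 * n))\<close> be expanded over one common
  range.\<close>

lemma ln_fact_eq_mangoldt_sum:
  assumes "n \<le> N"
  shows "ln (fact n) = (\<Sum>d=1..N. mangoldt d * real (n div d))"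
  using assms
proof (induction n)
  case 0
  then show ?case by simp
next
  case (Suc n)
  have "ln (fact (Suc n)) = ln (real (Suc n)) + ln (fact n :: real)"
    by (simp add: ln_mult del: of_nat_Suc)
  also have "ln (real (Suc n)) = (\<Sum>d | d dvd Suc n. mangoldt d)"
    using mangoldt_sum[of "Suc n", where ?'a = real] by simp
  also have "\<dots> = (\<Sum>d=1..N. if d dvd Suc n then mangoldt d else 0)"
  proof -
    have "{d. d dvd Suc n} = {d \<in> {1..N}. d dvd Suc n}"
      using Suc.prems by (auto simp: Suc_le_eq intro!: Nat.gr0I intro: le_trans[OF dvd_imp_le])
    then show ?thesis
      by (simp only: sum.inter_filter[OF finite_atLeastAtMost])
  qed
  also have "ln (fact n :: real) = (\<Sum>d=1..N. mangoldt d * real (n div d))"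
    using Suc by simp
  also have "(\<Sum>d=1..N. if d dvd Suc n then mangoldt d else 0)
      + (\<Sum>d=1..N. mangoldt d * real (n div d))
    = (\<Sum>d=1..N. mangoldt d * real (Suc n div d))"
    unfolding sum.distrib[symmetric]
    by (intro sum.cong) (auto simp: div_Suc dvd_eq_mod_eq_0 algebra_simps)
  finally show ?case .
qed

text \<open>This is the bound \<open>4 ^ n / (2 * n + 1)\<close> from below for the central binomial
  coefficient, cleared of denominators. The induction step rests on (2n+2)(2n+2) \<le>
  (2n+3)(2n+2).\<close>

lemma four_power_fact_le: "4 ^ n * (fact n)\<^sup>2 \<le> (2 * real n + 1) * fact (2 * n)"
proof (induction n)
  case (Suc n)
  have "4 ^ Suc n * (fact (Suc n))\<^sup>2 = 4 * (real n + 1)\<^sup>2 * (4 ^ n * (fact n)\<^sup>2)"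
    by (simp add: power2_eq_square algebra_simps)
  also have "\<dots> \<le> 4 * (real n + 1)\<^sup>2 * ((2 * real n + 1) * fact (2 * n))"
    by (intro mult_left_mono Suc) auto
  also have "\<dots> \<le> ((2 * real n + 3) * (2 * real n + 2)) * ((2 * real n + 1) * fact (2 * n))"
    by (intro mult_right_mono) (auto simp: power2_eq_square algebra_simps)
  also have "\<dots> = (2 * real (Suc n) + 1) * fact (2 * Suc n)"
    by (simp add: algebra_simps)
  finally show ?case .
qed simp

text \<open>Chebyshev's argument for psi(2n): in the logarithm of the central binomial coefficient,
  \<open>mangoldt d\<close> has the factor \<open>2 * n div d - 2 * (n div d)\<close>, which is at
  most 1.\<close>

lemma sum_mangoldt_ge:
  "real n * ln 4 - ln (2 * real n + 1) \<le> (\<Sum>d=1..2*n. mangoldt d)"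
proof -
  have "ln (4 ^ n * (fact n)\<^sup>2) \<le> ln ((2 * real n + 1) * fact (2 * n))"
    by (subst ln_le_cancel_iff) (use four_power_fact_le[of n] in auto)
  then have "real n * ln 4 - ln (2 * real n + 1) \<le> ln (fact (2 * n)) - 2 * ln (fact n)"
    by (simp add: ln_mult ln_realpow)
  also have "\<dots> = (\<Sum>d=1..2*n. mangoldt d * (real (2 * n div d) - 2 * real (n div d)))"
    by (subst ln_fact_eq_mangoldt_sum[of "2 * n" "2 * n"], simp,
        subst ln_fact_eq_mangoldt_sum[of n "2 * n"], simp,
        simp add: sum_distrib_left sum_subtractf[symmetric] algebra_simps)
  also have "\<dots> \<le> (\<Sum>d=1..2*n. mangoldt d * 1)"
  proof (intro sum_mono mult_left_mono)
    fix d assume "d \<in> {1..2*n}"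
    then have "n < (n div d + 1) * d"
      using dividend_less_div_times[of d n] by (simp add: algebra_simps)
    then have "2 * n div d < 2 * (n div d) + 2"
      using \<open>d \<in> _\<close> by (subst div_less_iff_less_mult) (auto simp: algebra_simps)
    then show "real (2 * n div d) - 2 * real (n div d) \<le> 1"
      by linarith
  qed (rule mangoldt_nonneg)
  finally show ?thesis by simp
qed

text \<open>The difference psi - theta comes from the proper prime powers up to \<open>m\<close>.
  Their bases satisfy p^2 \<le> m, so there are at most \<open>sqrt m\<close> bases, and the powers
  of each base contribute at most \<open>ln m\<close> in total.\<close>

lemma sum_mangoldt_le:
  assumes "m > 0"
  shows "(\<Sum>d=1..m. mangoldt d) \<le> prime_theta m + sqrt (real m) * ln (real m)"
proof -
  define Q where "Q = {q. primepow q \<and> \<not> prime q \<and> q \<le> m}"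
  define P where "P = {p. prime p \<and> p\<^sup>2 \<le> m}"
  have fin_Q: "finite Q"
    by (rule finite_subset[of _ "{..m}"]) (auto simp: Q_def)
  have P_sub: "P \<subseteq> {1..nat \<lfloor>sqrt (real m)\<rfloor>}"
  proof
    fix p assume "p \<in> P"
    then have "prime p" "(real p)\<^sup>2 \<le> real m"
      unfolding P_def by (auto simp flip: of_nat_power)
    then show "p \<in> {1..nat \<lfloor>sqrt (real m)\<rfloor>}"
      by (auto simp: le_nat_floor real_le_rsqrt Suc_le_eq prime_gt_0_nat)
  qed
  then have fin_P: "finite P"
    by (rule finite_subset) simp
  have "card P \<le> nat \<lfloor>sqrt (real m)\<rfloor>"
    using card_mono[OF _ P_sub] by simp
  then have card_P: "real (card P) \<le> sqrt (real m)"
    by (simp add: le_nat_floor le_nat_iff le_floor_iff)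
  have rep: "\<exists>k\<ge>2. q = aprimedivisor q ^ k \<and> aprimedivisor q \<in> P" if "q \<in> Q" for q
  proof -
    obtain p k where pk: "prime p" "k > 0" "q = p ^ k"
      using \<open>q \<in> Q\<close> by (auto simp: Q_def primepow_def)
    have "k \<noteq> 1"
      using that pk by (auto simp: Q_def)
    with pk have "k \<ge> 2" by simp
    moreover have "p\<^sup>2 \<le> p ^ k"
      using \<open>k \<ge> 2\<close> pk(1) by (intro power_increasing) (auto simp: Suc_le_eq prime_gt_0_nat)
    then have "p \<in> P"
      using pk that by (auto simp: P_def Q_def)
    ultimately show ?thesis
      using pk by (auto simp: aprimedivisor_prime_power)
  qed
  have fiber: "(\<Sum>q | q \<in> Q \<and> aprimedivisor q = p. mangoldt q) \<le> ln (real m)" if "p \<in> P" for p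
  proof -
    have p: "prime p" "real p > 1"
      using that prime_gt_1_nat by (auto simp: P_def)
    define K where "K = nat \<lfloor>log p m\<rfloor>"
    \<comment> \<open>At most \<open>K\<close> powers of \<open>p\<close> lie below
      \<open>m\<close>, each of weight \<open>ln p\<close>, and \<open>K * ln p\<close> is at most
      \<open>ln m\<close>. Admitting the exponent 1 here only overcounts.\<close>
    have "{q. q \<in> Q \<and> aprimedivisor q = p} \<subseteq> (\<lambda>k. p ^ k) ` {1..K}"
    proof
      fix q assume q: "q \<in> {q. q \<in> Q \<and> aprimedivisor q = p}"
      then obtain k where k: "k \<ge> 2" "q = p ^ k"
        using rep by auto
      then have "p ^ k \<le> m"
        using q by (auto simp: Q_def)
      then have "real p ^ k \<le> real m"
        by (simp flip: of_nat_power)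
      then have "real k \<le> log p m"
        using p \<open>m > 0\<close> by (simp add: le_log_iff powr_realpow)
      then have "k \<le> K"
        by (simp add: K_def le_nat_floor)
      then show "q \<in> (\<lambda>k. p ^ k) ` {1..K}"
        using k by auto
    qed
    then have "card {q. q \<in> Q \<and> aprimedivisor q = p} \<le> K"
      using surj_card_le[of "{1..K}"] by simp
    moreover have "log p m \<ge> 0"
      using p \<open>m > 0\<close> by simp
    then have "real K \<le> log p m"
      by (simp add: K_def)
    ultimately have "real (card {q. q \<in> Q \<and> aprimedivisor q = p}) \<le> log p m"
      by linarith
    then have "real (card {q. q \<in> Q \<and> aprimedivisor q = p}) * ln p \<le> ln m"
      using p by (simp add: log_def field_simps)
    moreover have "(\<Sum>q | q \<in> Q \<and> aprimedivisor q = p. mangoldt q)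
        = real (card {q. q \<in> Q \<and> aprimedivisor q = p}) * ln p"
      by (subst sum_constant[symmetric], intro sum.cong) (auto simp: mangoldt_def Q_def)
    ultimately show ?thesis by simp
  qed
  have "(\<Sum>d=1..m. mangoldt d) = (\<Sum>d\<in>{p. prime p \<and> p \<le> m} \<union> Q. mangoldt d :: real)"
    by (rule sum.mono_neutral_right)
       (auto simp: Q_def mangoldt_def Suc_le_eq prime_gt_0_nat primepow_gt_0_nat)
  also have "\<dots> = (\<Sum>p | prime p \<and> p \<le> m. mangoldt p) + (\<Sum>q\<in>Q. mangoldt q)"
    by (rule sum.union_disjoint) (auto simp: fin_Q finite_primes_le Q_def)
  also have "(\<Sum>p | prime p \<and> p \<le> m. mangoldt p) = prime_theta m"
    unfolding prime_theta_def by (intro sum.cong) auto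
  also have "(\<Sum>q\<in>Q. mangoldt q :: real)
      = (\<Sum>p\<in>P. \<Sum>q | q \<in> Q \<and> aprimedivisor q = p. mangoldt q)"
    by (rule sum.group[symmetric]) (use fin_Q fin_P rep in auto)
  also have "\<dots> \<le> (\<Sum>p\<in>P. ln (real m))"
    by (intro sum_mono fiber)
  also have "\<dots> = real (card P) * ln (real m)"
    by simp
  also have "\<dots> \<le> sqrt (real m) * ln (real m)"
    using card_P \<open>m > 0\<close> by (intro mult_right_mono) auto
  finally show ?thesis by simp
qed

text \<open>The inequality 1 + x \<le> exp x is taken at x = -0.681/128 and raised to the power 128;
  this exponent is large enough for the left side still to exceed 1/2.\<close>

lemma ln_2_gt: "ln 2 > (0.681 :: real)"
proof -
  have "1 + (- 0.681 / 128) \<le> exp (- 0.681 / 128 :: real)"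
    by (rule exp_ge_add_one_self)
  then have "(1 + (- 0.681 / 128)) ^ 128 \<le> exp (- 0.681 / 128 :: real) ^ 128"
    by (intro power_mono) auto
  also have "\<dots> = exp (- 0.681)"
    by (simp flip: exp_of_nat_mult)
  finally have "exp (- 0.681 :: real) > 1 / 2"
    by (simp add: field_simps)
  then have "exp (0.681 :: real) < 2"
    by (simp add: exp_minus field_simps)
  then show ?thesis
    by (metis exp_gt_zero ln_exp ln_less_cancel_iff zero_less_numeral)
qed

text \<open>The two bounds for psi(2n) are combined; the gap between 0.681 and 0.68 absorbs the
  logarithmic and square root errors for large arguments, and \<open>C\<close> takes care of the
  small ones.\<close>

lemma prime_theta_ge_linear: "\<exists>C\<ge>0. \<forall>m. prime_theta m \<ge> 0.68 * real m - C"
proof -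
  have "eventually (\<lambda>x::real. 0.68 * (2 * x + 1)
      \<le> 2 * 0.681 * x - ln (2 * x + 1) - sqrt (2 * x) * ln (2 * x)) at_top"
    by real_asymp
  then obtain x0 where x0: "\<And>x::real. x \<ge> x0 \<Longrightarrow> 0.68 * (2 * x + 1)
      \<le> 2 * 0.681 * x - ln (2 * x + 1) - sqrt (2 * x) * ln (2 * x)"
    unfolding eventually_at_top_linorder by blast
  \<comment> \<open>For \<open>m\<close> up to \<open>C\<close> the claim follows from nonnegativity
    of theta; beyond \<open>C\<close>, the half \<open>m div 2\<close> is positive and at least
    \<open>x0\<close>.\<close>
  define C where "C = 2 * \<bar>x0\<bar> + 3"
  have "prime_theta m \<ge> 0.68 * real m - C" for m
  proof (cases "real m \<le> C")
    case True
    then show ?thesis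
      using prime_theta_nonneg[of m] by simp
  next
    case False
    define n where "n = m div 2"
    have n: "real m \<le> 2 * real n + 1" "2 * n \<le> m"
      unfolding n_def by linarith+
    with False have "real n \<ge> x0" "n > 0"
      by (auto simp: C_def intro!: Nat.gr0I)
    have "ln (4::real) = 2 * ln 2"
      using ln_realpow[of "2::real" 2] by simp
    then have "2 * 0.681 * real n \<le> real n * ln 4"
      using mult_left_mono[of "0.681" "ln 2" "2 * real n"] ln_2_gt by simp
    moreover have "real n * ln 4 - ln (2 * real n + 1)
        \<le> prime_theta (2 * n) + sqrt (2 * real n) * ln (2 * real n)"
      using order_trans[OF sum_mangoldt_ge sum_mangoldt_le, of n] \<open>n > 0\<close> by simp
    ultimately have "2 * 0.681 * real n - ln (2 * real n + 1)
        \<le> prime_theta (2 * n) + sqrt (2 * real n) * ln (2 * real n)"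
      by linarith
    then have "0.68 * (2 * real n + 1) \<le> prime_theta (2 * n)"
      using x0[OF \<open>real n \<ge> x0\<close>] by simp
    also have "\<dots> \<le> prime_theta m"
      by (rule prime_theta_mono) (rule n)
    finally show ?thesis
      using n by (simp add: C_def)
  qed
  moreover have "C \<ge> 0" by (simp add: C_def)
  ultimately show ?thesis by blast
qed

section \<open>Partial summation over primes\<close>

text \<open>Abel summation: n^2 - p^2 is the sum of 2m + 1 over p \<le> m < n.\<close>

lemma sum_prime_weight_eq:
  "(\<Sum>p | prime p \<and> p \<le> n. (real n ^ 2 - real p ^ 2) * ln (real p))
    = (\<Sum>m<n. (2 * real m + 1) * prime_theta m)"
proof (induction n)
  case (Suc n)
  define w where "w = (\<lambda>n p::nat. (real n ^ 2 - real p ^ 2) * ln (real p))"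
  \<comment> \<open>A possible new prime \<open>p = Suc n\<close> has weight zero.\<close>
  have "(\<Sum>p | prime p \<and> p \<le> Suc n. w (Suc n) p) = (\<Sum>p | prime p \<and> p \<le> n. w (Suc n) p)"
    by (rule sum.mono_neutral_right)
       (auto simp: finite_primes_le w_def le_Suc_eq)
  also have "\<dots> = (\<Sum>p | prime p \<and> p \<le> n. w n p + (2 * real n + 1) * ln (real p))"
    by (intro sum.cong) (auto simp: w_def power2_eq_square algebra_simps)
  also have "\<dots> = (\<Sum>p | prime p \<and> p \<le> n. w n p) + (2 * real n + 1) * prime_theta n"
    by (simp add: sum.distrib prime_theta_def sum_distrib_left)
  finally show ?case
    using Suc unfolding w_def by simp
qed (auto intro!: sum.neutral)

lemma sum_prime_weight_ge:
  "\<exists>C. \<forall>n. (\<Sum>p | prime p \<and> p \<le> n. (real n ^ 2 - real p ^ 2) * ln (real p))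
    \<ge> real n ^ 2 * (0.68 * 2 / 3 * real n - C)"
proof -
  obtain C where C: "C \<ge> 0" "\<And>m. prime_theta m \<ge> 0.68 * real m - C"
    using prime_theta_ge_linear by blast
  \<comment> \<open>The leading term sums 2m * 0.68m. Using \<open>C + 1\<close> instead of
    \<open>C\<close> gains 2n + 1 in each induction step, which covers the lower order terms left
    over by the cubic.\<close>
  have step: "real n ^ 2 * (0.68 * 2 / 3 * real n - (C + 1))
      \<le> (\<Sum>m<n. (2 * real m + 1) * prime_theta m)" for n
  proof (induction n)
    case (Suc n)
    have "real (Suc n) ^ 2 * (0.68 * 2 / 3 * real (Suc n) - (C + 1))
        \<le> real n ^ 2 * (0.68 * 2 / 3 * real n - (C + 1)) + (2 * real n + 1) * (0.68 * real n - C)"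
      by (simp add: power2_eq_square field_simps)
    also have "\<dots> \<le> (\<Sum>m<n. (2 * real m + 1) * prime_theta m) + (2 * real n + 1) * prime_theta n"
      by (intro add_mono Suc mult_left_mono C) auto
    finally show ?case by simp
  qed simp
  show ?thesis
    unfolding sum_prime_weight_eq using step by blast
qed

section \<open>Subset sums of units modulo m\<close>

text \<open>A new unit \<open>a x\<close> either enlarges the set of attained residues or leaves it
  closed under translation by \<open>a x\<close>. In the latter case the set contains 0, hence all
  multiples of the unit, hence every residue.\<close>

lemma card_subset_sums_mod_ge:
  fixes a :: "'b \<Rightarrow> int"
  assumes "finite I" "m > 0" "\<And>i. i \<in> I \<Longrightarrow> coprime (a i) (int m)"
  shows "card ((\<lambda>S. (\<Sum>i\<in>S. a i) mod int m) ` Pow I) \<ge> min m (card I + 1)"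
  using assms(1,3)
proof (induction I rule: finite_induct)
  case empty
  then show ?case by simp
next
  case (insert x I)
  define R where "R = (\<lambda>J. (\<lambda>S. (\<Sum>i\<in>S. a i) mod int m) ` Pow J)"
  have sub: "R I \<subseteq> R (insert x I)"
    unfolding R_def by auto
  have fin: "finite (R (insert x I))"
    using insert by (simp add: R_def)
  have shift: "(r + a x) mod int m \<in> R (insert x I)" if "r \<in> R I" for r
  proof -
    obtain S where S: "S \<subseteq> I" "r = (\<Sum>i\<in>S. a i) mod int m"
      using \<open>r \<in> R I\<close> unfolding R_def by blast
    have "finite S" "x \<notin> S"
      using finite_subset[OF S(1)] S(1) insert.hyps by blast+
    then have "(r + a x) mod int m = (\<Sum>i\<in>insert x S. a i) mod int m"
      using S by (simp add: mod_add_left_eq mod_add_right_eq add.commute)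
    moreover have "insert x S \<in> Pow (insert x I)"
      using S by auto
    ultimately show ?thesis
      unfolding R_def by (metis image_eqI)
  qed
  show ?case
  proof (cases "R (insert x I) = R I")
    case True
    have mult: "(int k * a x) mod int m \<in> R I" for k
    proof (induction k)
      case 0
      have "{} \<in> Pow I" by simp
      then show ?case unfolding R_def by force
    next
      case (Suc k)
      have "(int (Suc k) * a x) mod int m = (int k * a x + a x) mod int m"
        by (simp add: algebra_simps)
      also have "\<dots> = ((int k * a x) mod int m + a x) mod int m"
        by (simp add: mod_add_left_eq)
      finally show ?case
        using shift[OF Suc] True by simp
    qed
    have "{0..<int m} \<subseteq> R I"
    proof
      fix t assume t: "t \<in> {0..<int m}"
      obtain b where b: "[a x * b = 1] (mod int m)"
        using cong_solve_coprime_int[of "a x" "int m"] insert.prems by auto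
      \<comment> \<open>With \<open>b\<close> inverse to \<open>a x\<close>, this multiple of
        \<open>a x\<close> is congruent to \<open>t\<close>.\<close>
      define k where "k = nat ((b * t) mod int m)"
      have "int k = (b * t) mod int m"
        using \<open>m > 0\<close> by (simp add: k_def)
      then have "[int k * a x = (b * t) * a x] (mod int m)"
        by (intro cong_mult) (auto simp: unique_euclidean_semiring_class.cong_def)
      also have "(b * t) * a x = (a x * b) * t"
        by (simp add: algebra_simps)
      also have "[(a x * b) * t = 1 * t] (mod int m)"
        by (intro cong_mult b) auto
      finally have "(int k * a x) mod int m = t"
        using t by (simp add: unique_euclidean_semiring_class.cong_def)
      then show "t \<in> R I"
        using mult[of k] by simp
    qed
    then have "m \<le> card (R I)"
      using card_mono[of "R I" "{0..<int m}"] fin True by simp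
    then show ?thesis
      using True unfolding R_def by simp
  next
    case False
    then have "card (R I) < card (R (insert x I))"
      using sub fin by (intro psubset_card_mono) auto
    moreover have "min m (card I + 1) \<le> card (R I)"
      using insert unfolding R_def by simp
    ultimately show ?thesis
      using insert.hyps unfolding R_def by simp
  qed
qed

text \<open>The empty sum already supplies one residue, so \<open>m - 1\<close> units suffice to
  reach all \<open>m\<close> classes.\<close>

lemma subset_sum_cong:
  fixes a :: "'b \<Rightarrow> int"
  assumes "finite I" "m > 0" "\<And>i. i \<in> I \<Longrightarrow> coprime (a i) (int m)" "m \<le> card I + 1"
  obtains S where "S \<subseteq> I" "[(\<Sum>i\<in>S. a i) = t] (mod int m)"
proof -
  let ?R = "(\<lambda>S. (\<Sum>i\<in>S. a i) mod int m) ` Pow I"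
  have "?R \<subseteq> {0..<int m}"
    using \<open>m > 0\<close> by auto
  moreover have "card {0..<int m} \<le> card ?R"
    using card_subset_sums_mod_ge[OF assms(1-3)] assms(4) by simp
  ultimately have "?R = {0..<int m}"
    by (intro card_seteq) auto
  moreover have "t mod int m \<in> {0..<int m}"
    using \<open>m > 0\<close> by simp
  ultimately obtain S where "S \<subseteq> I" "t mod int m = (\<Sum>i\<in>S. a i) mod int m"
    by blast
  then show ?thesis
    by (intro that[of S]) (simp_all add: unique_euclidean_semiring_class.cong_def)
qed

section \<open>Prime divisors of the generators of a powerful cube\<close>

lemma subset_sum_in_hilbert_cube:
  assumes "S \<subseteq> {1..d}" "a0 \<noteq> 0 \<or> S \<noteq> {}"
  shows "a0 + (\<Sum>i\<in>S. a i) \<in> hilbert_cube a0 d a"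
proof -
  define \<epsilon> :: "nat \<Rightarrow> int" where "\<epsilon> = (\<lambda>i. if i \<in> S then 1 else 0)"
  have "finite S" and S: "{1..d} \<inter> S = S"
    using assms(1) finite_subset by auto
  have \<epsilon>: "\<forall>i\<in>{1..d}. \<epsilon> i \<in> {0, 1}"
    by (simp add: \<epsilon>_def)
  have sum_a: "(\<Sum>i=1..d. \<epsilon> i * a i) = (\<Sum>i\<in>S. a i)"
    using sum.inter_restrict[of "{1..d}" a S] S by (simp add: \<epsilon>_def if_distrib[of "\<lambda>x. x * _"] cong: if_cong)
  have sum_\<epsilon>: "(\<Sum>i=1..d. \<epsilon> i) = int (card S)"
    using sum.inter_restrict[of "{1..d}" "\<lambda>_. 1::int" S] S by (simp add: \<epsilon>_def)
  show ?thesis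
  proof (cases "a0 = 0")
    case True
    with assms(2) \<open>finite S\<close> have "(\<Sum>i=1..d. \<epsilon> i) > 0"
      unfolding sum_\<epsilon> by (simp add: card_gt_0_iff)
    then show ?thesis
      using True \<epsilon> sum_a by (auto simp: hilbert_cube_def intro!: exI[of _ \<epsilon>])
  next
    case False
    then show ?thesis
      using \<epsilon> sum_a by (auto simp: hilbert_cube_def intro!: exI[of _ \<epsilon>])
  qed
qed

text \<open>Among \<open>p\<^sup>2 - 1\<close> generators prime to \<open>p\<close> the subset sums cover every residue class
  modulo \<open>p\<^sup>2\<close>; the class of \<open>p - a0\<close> yields a cube element divisible by \<open>p\<close> exactly once.\<close>

lemma card_not_dvd_less:
  assumes "prime p" "hilbert_cube a0 d a \<subseteq> int ` powerful_numbers"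
  shows "card {i \<in> {1..d}. \<not> int p dvd a i} < p\<^sup>2"
proof (rule ccontr)
  assume contr: "\<not> ?thesis"
  define I where "I = {i \<in> {1..d}. \<not> int p dvd a i}"
  have "coprime (a i) (int (p\<^sup>2))" if "i \<in> I" for i
    using that prime_imp_coprime[of "int p" "a i"] \<open>prime p\<close>
    by (auto simp: I_def coprime_commute)
  then obtain S where S: "S \<subseteq> I" "[(\<Sum>i\<in>S. a i) = int p - a0] (mod int (p\<^sup>2))"
    using subset_sum_cong[of I "p\<^sup>2" a] contr prime_gt_0_nat[OF \<open>prime p\<close>]
    by (auto simp: I_def)
  define s where "s = a0 + (\<Sum>i\<in>S. a i)"
  have not_dvd: "\<not> int (p\<^sup>2) dvd int p"
    using prime_gt_1_nat[OF \<open>prime p\<close>] by (auto simp: power2_eq_square simp flip: of_nat_mult)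
  have s: "[s = int p] (mod int (p\<^sup>2))"
    using cong_add[OF cong_refl S(2), of a0] by (simp add: s_def)
  \<comment> \<open>The excluded empty sum cannot be the one found: it would give
    \<open>s = 0\<close>, while \<open>s\<close> is congruent to \<open>p\<close>, which is nonzero
    modulo \<open>p\<^sup>2\<close>.\<close>
  have "a0 \<noteq> 0 \<or> S \<noteq> {}"
  proof (rule ccontr)
    assume "\<not> ?thesis"
    then have "s = 0" by (simp add: s_def)
    then show False
      using cong_dvd_iff[OF s] not_dvd by simp
  qed
  then have "s \<in> hilbert_cube a0 d a"
    using S(1) unfolding s_def I_def by (intro subset_sum_in_hilbert_cube) auto
  then obtain n where n: "s = int n" "n \<in> powerful_numbers"
    using assms(2) by auto
  have "int p dvd s"
    using cong_dvd_modulus[OF s, of "int p"] by (simp add: cong_dvd_iff)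
  then have "int (p\<^sup>2) dvd s"
    using n \<open>prime p\<close> by (auto simp: powerful_numbers_def simp del: of_nat_power)
  then show False
    using s not_dvd by (simp add: cong_dvd_iff)
qed

lemma sum_ln_primes_dvd_le:
  assumes "finite P" "\<And>p. p \<in> P \<Longrightarrow> prime p \<and> p dvd n" "n > 0"
  shows "(\<Sum>p\<in>P. ln (real p)) \<le> ln (real n)"
proof -
  have "\<Prod>P dvd n"
    using assms(1,2)
    by (induction rule: finite_induct)
       (auto intro!: divides_mult prod_coprime_right intro: primes_coprime)
  then have "\<Prod>P \<le> n"
    using assms by (intro dvd_imp_le) auto
  then have "(\<Prod>p\<in>P. real p) \<le> real n"
    by (simp flip: of_nat_prod)
  moreover have pos: "(\<Prod>p\<in>P. real p) > 0"
    using assms by (intro prod_pos) (auto dest: prime_gt_0_nat)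
  ultimately have "ln (\<Prod>p\<in>P. real p) \<le> ln (real n)"
    using assms(3) by simp
  moreover have "ln (\<Prod>p\<in>P. real p) = (\<Sum>p\<in>P. ln (real p))"
    using assms by (intro ln_prod) (auto dest: prime_gt_0_nat)
  ultimately show ?thesis by simp
qed

text \<open>Double counting of the pairs with \<open>p dvd a i\<close>: each prime \<open>p\<close>
  has at least d - p^2 such indices, and each index \<open>i\<close> carries total weight at most
  \<open>ln (a i)\<close>. Primes with p^2 > d do no harm, since their terms on the left are not
  positive.\<close>

lemma powerful_cube_weight_le:
  assumes pos: "\<forall>i\<in>{1..d}. a i > 0" and "a0 \<ge> 0"
    and cube: "hilbert_cube a0 d a \<subseteq> int ` (powerful_numbers \<inter> {1..N})"
  shows "(\<Sum>p | prime p \<and> p \<le> n. (real d - real p ^ 2) * ln (real p)) \<le> real d * ln (real N)"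
proof -
  define D where "D = (\<lambda>p. {i \<in> {1..d}. int p dvd a i})"
  \<comment> \<open>The element \<open>a0 + a i\<close> belongs to the cube, and \<open>a0\<close>
    is nonnegative.\<close>
  have a_le: "a i \<le> int N" if "i \<in> {1..d}" for i
    using subset_sum_in_hilbert_cube[of "{i}" d a0 a] that cube \<open>a0 \<ge> 0\<close> by auto
  have "real d - real p ^ 2 \<le> real (card (D p))" if "prime p" for p
  proof -
    have "{1..d} = D p \<union> {i \<in> {1..d}. \<not> int p dvd a i}"
      by (auto simp: D_def)
    then have "d = card (D p \<union> {i \<in> {1..d}. \<not> int p dvd a i})"
      by (metis card_atLeastAtMost diff_Suc_1)
    also have "\<dots> \<le> card (D p) + card {i \<in> {1..d}. \<not> int p dvd a i}"
      by (rule card_Un_le)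
    also have "\<dots> \<le> card (D p) + p\<^sup>2"
      using card_not_dvd_less[OF that, of a0 d a] cube by fastforce
    finally show ?thesis
      by (simp flip: of_nat_power)
  qed
  then have "(\<Sum>p | prime p \<and> p \<le> n. (real d - real p ^ 2) * ln (real p))
      \<le> (\<Sum>p | prime p \<and> p \<le> n. real (card (D p)) * ln (real p))"
    by (intro sum_mono mult_right_mono) (auto dest: prime_ge_1_nat)
  also have "\<dots> = (\<Sum>p | prime p \<and> p \<le> n. \<Sum>i | i \<in> {1..d} \<and> int p dvd a i. ln (real p))"
    by (simp add: D_def)
  also have "\<dots> = (\<Sum>i=1..d. \<Sum>p | p \<in> {p. prime p \<and> p \<le> n} \<and> int p dvd a i. ln (real p))"
    by (rule sum.swap_restrict) (auto simp: finite_primes_le)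
  also have "\<dots> \<le> (\<Sum>i=1..d. ln (real N))"
  proof (rule sum_mono)
    fix i assume i: "i \<in> {1..d}"
    then have "a i > 0" using pos by blast
    have "p dvd nat (a i)" if "int p dvd a i" for p
      using that \<open>a i > 0\<close> by (metis int_dvd_int_iff int_nat_eq less_imp_le)
    then have "(\<Sum>p | p \<in> {p. prime p \<and> p \<le> n} \<and> int p dvd a i. ln (real p)) \<le> ln (real (nat (a i)))"
      using \<open>a i > 0\<close> finite_primes_le[of n] by (intro sum_ln_primes_dvd_le) auto
    also have "\<dots> \<le> ln (real N)"
      using \<open>a i > 0\<close> a_le[OF i] by simp
    finally show "(\<Sum>p | p \<in> {p. prime p \<and> p \<le> n} \<and> int p dvd a i. ln (real p)) \<le> ln (real N)" .
  qed
  finally show ?thesis by simp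
qed

section \<open>Comparison of the lower and upper bounds\<close>

theorem theorem3:
  shows "\<exists>N0::nat. \<forall>N\<ge>N0. \<forall>(a0::int) (d::nat) (a::nat \<Rightarrow> int).
           a0 \<ge> 0 \<longrightarrow>
           inj_on a {1..d} \<longrightarrow>
           (\<forall>i\<in>{1..d}. a i > 0) \<longrightarrow>
           hilbert_cube a0 d a \<subseteq> int ` (powerful_numbers \<inter> {1..N}) \<longrightarrow>
           real d \<le> 5 * (ln (real N))\<^sup>2"
proof -
  obtain C where C: "\<And>n. real n ^ 2 * (0.68 * 2 / 3 * real n - C)
      \<le> (\<Sum>p | prime p \<and> p \<le> n. (real n ^ 2 - real p ^ 2) * ln (real p))"
    using sum_prime_weight_ge by blast
  \<comment> \<open>The coefficient 0.68 * 2 / 3 * 2.236 is about 1.0137; being above 1, it beats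
    the constants for large \<open>N\<close>.\<close>
  have "eventually (\<lambda>N::nat. 0.68 * 2 / 3 * (2.236 * ln (real N) - 1) - C > ln (real N)
      \<and> ln (real N) > 1) at_top"
    by (intro eventually_conj; real_asymp)
  then obtain N0 where N0: "\<And>N. N \<ge> N0 \<Longrightarrow>
      0.68 * 2 / 3 * (2.236 * ln (real N) - 1) - C > ln (real N) \<and> ln (real N) > 1"
    unfolding eventually_at_top_linorder by blast
  show ?thesis
  proof (intro exI[of _ N0] allI impI)
    fix N d :: nat and a0 :: int and a :: "nat \<Rightarrow> int"
    assume "N \<ge> N0" "a0 \<ge> 0" and pos: "\<forall>i\<in>{1..d}. a i > 0"
      and cube: "hilbert_cube a0 d a \<subseteq> int ` (powerful_numbers \<inter> {1..N})"
    define L where "L = ln (real N)"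
    have L: "0.68 * 2 / 3 * (2.236 * L - 1) - C > L" "L > 1"
      using N0[OF \<open>N \<ge> N0\<close>] by (auto simp: L_def)
    show "real d \<le> 5 * (ln (real N))\<^sup>2"
    proof (rule ccontr)
      assume "\<not> ?thesis"
      then have d: "real d > 5 * L\<^sup>2" by (simp add: L_def)
      then have d_pos: "real d > 0"
        using zero_le_power2[of L] by linarith
      \<comment> \<open>The constant 2.236 lies just below \<open>sqrt 5\<close>, which ensures n^2
        \<le> d.\<close>
      define x where "x = 2.236 * L"
      define n where "n = nat \<lfloor>x\<rfloor>"
      have "x > 1"
        using \<open>L > 1\<close> by (simp add: x_def)
      then have n: "real n \<le> 2.236 * L" "real n > 2.236 * L - 1"
        unfolding n_def x_def[symmetric] by linarith+
      have "n > 0"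
        using n(2) \<open>L > 1\<close> by (auto intro!: Nat.gr0I)
      have "real n ^ 2 \<le> (2.236 * L) ^ 2"
        using n by (intro power_mono) auto
      also have "\<dots> \<le> 5 * L\<^sup>2"
        by (simp add: power_mult_distrib power2_eq_square)
      finally have nd: "real n ^ 2 \<le> real d"
        using d by linarith
      have "real d * (real n ^ 2 * (0.68 * 2 / 3 * real n - C))
          \<le> real d * (\<Sum>p | prime p \<and> p \<le> n. (real n ^ 2 - real p ^ 2) * ln (real p))"
        using C[of n] by (intro mult_left_mono) auto
      also have "\<dots> = (\<Sum>p | prime p \<and> p \<le> n. (real d * (real n ^ 2 - real p ^ 2)) * ln (real p))"
        by (simp add: sum_distrib_left mult.assoc)
      also have "\<dots> \<le> (\<Sum>p | prime p \<and> p \<le> n. (real n ^ 2 * (real d - real p ^ 2)) * ln (real p))"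
      proof (intro sum_mono mult_right_mono)
        fix p
        \<comment> \<open>Divided by d * n^2 this reads 1 - p^2/n^2 \<le> 1 - p^2/d. It trades the
          weights of the counting bound for those of the partial summation.\<close>
        show "real d * (real n ^ 2 - real p ^ 2) \<le> real n ^ 2 * (real d - real p ^ 2)"
          using mult_right_mono[OF nd, of "real p ^ 2"] by (simp add: algebra_simps)
      qed (auto dest: prime_ge_1_nat)
      also have "\<dots> = real n ^ 2 * (\<Sum>p | prime p \<and> p \<le> n. (real d - real p ^ 2) * ln (real p))"
        by (simp add: sum_distrib_left mult.assoc)
      also have "\<dots> \<le> real n ^ 2 * (real d * L)"
        unfolding L_def
        by (intro mult_left_mono powerful_cube_weight_le[OF pos \<open>a0 \<ge> 0\<close> cube]) auto
      finally have "(real d * real n ^ 2) * (0.68 * 2 / 3 * real n - C) \<le> (real d * real n ^ 2) * L"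
        by (simp add: algebra_simps)
      then have "0.68 * 2 / 3 * real n - C \<le> L"
        using d_pos \<open>n > 0\<close> by (simp add: mult_le_cancel_left_pos)
      moreover have "0.68 * 2 / 3 * (2.236 * L - 1) \<le> 0.68 * 2 / 3 * real n"
        using n(2) by simp
      ultimately show False
        using L(1) by linarith
    qed
  qed
qed

end
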